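(* Let $C$ be a full subcategory of $(L,V)\text{-}\mathtt{Cat}$ which contains all $V$-quantales, and let $(X,a)$ be a separated object in $C$. Then $(X,a)$ is injective in $C$ (with respect to the morphisms of $C$ that are fully faithful $(L,V)$-functors) if and only if it is a $V$-quantale (that is, $(X,a)=\mathtt{Kmp}(Q)$ for some $V$-quantale $Q$).
   Context: $(V,\otimes,k)$ is a commutative quantale: a complete lattice with a commutative monoid structure $(\otimes,k)$ such that $\otimes$ preserves suprema in each variable; it is assumed non-trivial, $k\neq\perp$. $[u,-]$ denotes the right adjoint of $u\otimes -$. A $V$-category $(X,a)$ is a set $X$ with a map $a:X\times X\to V$ (also written $X(-,-)$) such that $k\le a(x,x)$ and $a(x,y)\otimes a(y,z)\le a(x,z)$. A $V$-functor $f:(X,a)\to(Y,b)$ is a map with $a(x,y)\le b(f(x),f(y))$. $x\le y$ means $k\le a(x,y)$; $X$ is separated if $x\le y\le x$ implies $x=y$. $X\boxtimes Y$ is $X\times Y$ with structure $a(x,x')\otimes b(y,y')$; $X^{\mathrm{op}}$ has structure $a^\circ(x,y)=a(y,x)$; $V$ is a $V$-category via $[-,-]$. $(X,a)$ is cocomplete if for every $V$-category $A$, $V$-functors $f:A\to X$ and $\phi:A^{\mathrm{op}}\to V$, there is $c\in X$ with $a(c,y)=\bigwedge_{s\in A}[\phi(s),a(f(s),y)]$ for all $y\in X$ (the colimit of $f$ weighted by $\phi$). A $V$-functor is cocontinuous if it preserves all such weighted colimits. A monoidal $V$-category $(X,a,\ast,u_X)$ is a $V$-category with a monoid structure on $X$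 such that $\ast:X\boxtimes X\to X$ is a $V$-functor. A $V$-quantale is a separated cocomplete monoidal $V$-category $(Q,\ast,k_Q)$ such that $x\ast(-)$ and $(-)\ast x$ are cocontinuous for every $x\in Q$. $LX$ is the set of finite lists (including the empty list $()$) on $X$; $(\underline{x};\underline{w})$ is concatenation; $Lf(x_1,\dots,x_n)=(f(x_1),\dots,f(x_n))$. An $(L,V)$-category $(X,a)$ is a set $X$ with a map $a:LX\times X\to V$ such that $k\le a((x),x)$ and, for all lists $\underline{x}_1,\dots,\underline{x}_n\in LX$, $\underline{y}=(y_1,\dots,y_n)\in LX$, $z\in X$: $a(\underline{x}_1,y_1)\otimes\cdots\otimes a(\underline{x}_n,y_n)\otimes a(\underline{y},z)\le a((\underline{x}_1;\dots;\underline{x}_n),z)$. An $(L,V)$-functor $f:(X,a)\to(Y,b)$ is a map with $a(\underline{x},y)\le b(Lf(\underline{x}),f(y))$ for all $\underline{x}\in LX$, $y\in X$; it is fully faithful if equality always holds. These form the category $(L,V)\text{-}\mathtt{Cat}$. $(X,a)$ is separated if $k\le a((x),y)$ and $k\le a((y),x)$ imply $x=y$. A monoidal $V$-category $(X,a,\ast,u_X)$ is viewed as an $(L,V)$-category $\mathtt{Kmp}(X)$ with structure $\tilde a((x_1,\dots,x_n),y)=a(x_1\ast\cdots\ast x_n,y)$, $\tilde a((),y)=a(u_X,y)$; in particular $V$-quantales are viewed as $(L,V)$-categories this way. An object $X$ of a category is injective with respect to a class $J$ of morphisms if for every $m:Y\to Z$ in $J$ and every $h:Y\to X$ there is $\bar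 h:Z\to X$ with $\bar h m=h$. *)

theory Defs
  imports Main "HOL-Library.FuncSet"
begin

section \<open>Commutative quantales\<close>

text \<open>The quantale is the whole type \<open>'v\<close>, with tensor \<open>*\<close> and neutral element \<open>1\<close>.
  By commutativity, preservation of suprema in one variable is enough.\<close>

class comm_quantale = complete_lattice + comm_monoid_mult +
  assumes mult_Sup: "x * Sup A = Sup ((\<lambda>y. x * y) ` A)"

definition qhom :: "'v::comm_quantale \<Rightarrow> 'v \<Rightarrow> 'v"
  where "qhom u w = Sup {v. u * v \<le> w}"

lemma mult_left_mono_quantale:
  fixes u v w :: "'v::comm_quantale"
  assumes "v \<le> w"
  shows "u * v \<le> u * w"
proof -
  have "u * w = u * Sup {v, w}"
    using assms by (simp add: sup_absorb2)
  also have "\<dots> = sup (u * v) (u * w)"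
    by (subst mult_Sup) simp
  finally show ?thesis
    by (metis sup_ge1)
qed

lemma qhom_adjoint:
  fixes u v w :: "'v::comm_quantale"
  shows "u * v \<le> w \<longleftrightarrow> v \<le> qhom u w"
proof
  assume "u * v \<le> w"
  then show "v \<le> qhom u w"
    unfolding qhom_def by (intro Sup_upper) simp
next
  assume "v \<le> qhom u w"
  then have "u * v \<le> u * qhom u w"
    by (rule mult_left_mono_quantale)
  also have "\<dots> \<le> w"
    unfolding qhom_def mult_Sup by (auto intro: Sup_least)
  finally show "u * v \<le> w" .
qed


section \<open>Categories enriched in a quantale\<close>

record ('a, 'v) vcat =
  ob :: "'a set"
  hom :: "'a \<Rightarrow> 'a \<Rightarrow> 'v"

definition is_vcat :: "('a, 'v::comm_quantale, 'z) vcat_scheme \<Rightarrow> bool"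
  where "is_vcat X \<longleftrightarrow>
    (\<forall>x\<in>ob X. 1 \<le> hom X x x) \<and>
    (\<forall>x\<in>ob X. \<forall>y\<in>ob X. \<forall>z\<in>ob X. hom X x y * hom X y z \<le> hom X x z)"

definition vfunctor ::
  "('a, 'v::comm_quantale, 'y) vcat_scheme \<Rightarrow> ('b, 'v, 'z) vcat_scheme \<Rightarrow> ('a \<Rightarrow> 'b) \<Rightarrow> bool"
  where "vfunctor X Y f \<longleftrightarrow>
    f \<in> ob X \<rightarrow> ob Y \<and>
    (\<forall>x\<in>ob X. \<forall>x'\<in>ob X. hom X x x' \<le> hom Y (f x) (f x'))"

definition vle :: "('a, 'v::comm_quantale, 'z) vcat_scheme \<Rightarrow> 'a \<Rightarrow> 'a \<Rightarrow> bool"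
  where "vle X x y \<longleftrightarrow> 1 \<le> hom X x y"

definition vseparated :: "('a, 'v::comm_quantale, 'z) vcat_scheme \<Rightarrow> bool"
  where "vseparated X \<longleftrightarrow> (\<forall>x\<in>ob X. \<forall>y\<in>ob X. vle X x y \<and> vle X y x \<longrightarrow> x = y)"

definition vtensor ::
  "('a, 'v::comm_quantale, 'y) vcat_scheme \<Rightarrow> ('b, 'v, 'z) vcat_scheme \<Rightarrow> ('a \<times> 'b, 'v) vcat"
  where "vtensor X Y =
    \<lparr>ob = ob X \<times> ob Y, hom = (\<lambda>(x, y) (x', y'). hom X x x' * hom Y y y')\<rparr>"

definition vop :: "('a, 'v::comm_quantale, 'z) vcat_scheme \<Rightarrow> ('a, 'v) vcat"
  where "vop X = \<lparr>ob = ob X, hom = (\<lambda>x y. hom X y x)\<rparr>"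

definition vself :: "('v, 'v::comm_quantale) vcat"
  where "vself = \<lparr>ob = UNIV, hom = qhom\<rparr>"

text \<open>The parameter \<open>S\<close> below is the collection of those subsets of \<open>'u\<close> that count as (small)
  sets; the indexing categories of weighted colimits range over it.\<close>

definition is_weight ::
  "'u set set \<Rightarrow> ('u, 'v::comm_quantale, 'z) vcat_scheme \<Rightarrow> ('u, 'v) vcat \<Rightarrow>
    ('u \<Rightarrow> 'u) \<Rightarrow> ('u \<Rightarrow> 'v) \<Rightarrow> bool"
  where "is_weight S X A f \<phi> \<longleftrightarrow>
    ob A \<in> S \<and> is_vcat A \<and> vfunctor A X f \<and> vfunctor (vop A) vself \<phi>"

definition is_colimit ::
  "('u, 'v::comm_quantale, 'z) vcat_scheme \<Rightarrow> ('u, 'v) vcat \<Rightarrow>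
    ('u \<Rightarrow> 'u) \<Rightarrow> ('u \<Rightarrow> 'v) \<Rightarrow> 'u \<Rightarrow> bool"
  where "is_colimit X A f \<phi> c \<longleftrightarrow>
    c \<in> ob X \<and> (\<forall>y\<in>ob X. hom X c y = (INF s\<in>ob A. qhom (\<phi> s) (hom X (f s) y)))"

definition cocomplete :: "'u set set \<Rightarrow> ('u, 'v::comm_quantale, 'z) vcat_scheme \<Rightarrow> bool"
  where "cocomplete S X \<longleftrightarrow>
    (\<forall>A f \<phi>. is_weight S X A f \<phi> \<longrightarrow> (\<exists>c. is_colimit X A f \<phi> c))"

definition cocontinuous ::
  "'u set set \<Rightarrow> ('u, 'v::comm_quantale, 'y) vcat_scheme \<Rightarrow> ('u, 'v, 'z) vcat_scheme \<Rightarrow>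
    ('u \<Rightarrow> 'u) \<Rightarrow> bool"
  where "cocontinuous S X Y g \<longleftrightarrow>
    vfunctor X Y g \<and>
    (\<forall>A f \<phi> c. is_weight S X A f \<phi> \<and> is_colimit X A f \<phi> c \<longrightarrow>
      is_colimit Y A (g \<circ> f) \<phi> (g c))"


section \<open>Monoidal enriched categories and enriched quantales\<close>

record ('a, 'v) mvcat = "('a, 'v) vcat" +
  mul :: "'a \<Rightarrow> 'a \<Rightarrow> 'a"
  unt :: "'a"

definition is_mvcat :: "('a, 'v::comm_quantale) mvcat \<Rightarrow> bool"
  where "is_mvcat X \<longleftrightarrow>
    is_vcat X \<and>
    unt X \<in> ob X \<and>
    (\<forall>x\<in>ob X. mul X (unt X) x = x \<and> mul X x (unt X) = x) \<and>
    (\<forall>x\<in>ob X. \<forall>y\<in>ob X. \<forall>z\<in>ob X. mul X (mul X x y) z = mul X x (mul X y z)) \<and>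
    vfunctor (vtensor X X) X (\<lambda>(x, y). mul X x y)"

definition vquantale :: "'u set set \<Rightarrow> ('u, 'v::comm_quantale) mvcat \<Rightarrow> bool"
  where "vquantale S Q \<longleftrightarrow>
    is_mvcat Q \<and> vseparated Q \<and> cocomplete S Q \<and>
    (\<forall>x\<in>ob Q. cocontinuous S Q Q (\<lambda>y. mul Q x y) \<and> cocontinuous S Q Q (\<lambda>y. mul Q y x))"


section \<open>Categories enriched in a quantale with lists as sources\<close>

record ('a, 'v) lvcat =
  lob :: "'a set"
  lhom :: "'a list \<Rightarrow> 'a \<Rightarrow> 'v"

text \<open>The structure map is normalised to \<open>undefined\<close> outside its domain, so that equality of
  records is equality of the structures they represent.\<close>

definition is_lvcat :: "('a, 'v::comm_quantale) lvcat \<Rightarrow> bool"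
  where "is_lvcat X \<longleftrightarrow>
    (\<forall>xs y. xs \<notin> lists (lob X) \<or> y \<notin> lob X \<longrightarrow> lhom X xs y = undefined) \<and>
    (\<forall>x\<in>lob X. 1 \<le> lhom X [x] x) \<and>
    (\<forall>xss\<in>lists (lists (lob X)). \<forall>ys\<in>lists (lob X). \<forall>z\<in>lob X.
      length xss = length ys \<longrightarrow>
      prod_list (map2 (lhom X) xss ys) * lhom X ys z \<le> lhom X (concat xss) z)"

definition lvfunctor ::
  "('a, 'v::comm_quantale) lvcat \<Rightarrow> ('b, 'v) lvcat \<Rightarrow> ('a \<Rightarrow> 'b) \<Rightarrow> bool"
  where "lvfunctor X Y f \<longleftrightarrow>
    f \<in> lob X \<rightarrow> lob Y \<and>
    (\<forall>xs\<in>lists (lob X). \<forall>y\<in>lob X. lhom X xs y \<le> lhom Y (map f xs) (f y))"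

definition fully_faithful ::
  "('a, 'v::comm_quantale) lvcat \<Rightarrow> ('b, 'v) lvcat \<Rightarrow> ('a \<Rightarrow> 'b) \<Rightarrow> bool"
  where "fully_faithful X Y f \<longleftrightarrow>
    lvfunctor X Y f \<and>
    (\<forall>xs\<in>lists (lob X). \<forall>y\<in>lob X. lhom X xs y = lhom Y (map f xs) (f y))"

definition lvseparated :: "('a, 'v::comm_quantale) lvcat \<Rightarrow> bool"
  where "lvseparated X \<longleftrightarrow>
    (\<forall>x\<in>lob X. \<forall>y\<in>lob X. 1 \<le> lhom X [x] y \<and> 1 \<le> lhom X [y] x \<longrightarrow> x = y)"

text \<open>The right fold computes \<open>x1 * (x2 * (\<dots> * (xn * u)))\<close>, that is, the product of the list in
  the monoid.\<close>

definition Kmp :: "('a, 'v::comm_quantale) mvcat \<Rightarrow> ('a, 'v) lvcat"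
  where "Kmp X =
    \<lparr>lob = ob X,
     lhom = (\<lambda>xs y. if xs \<in> lists (ob X) \<and> y \<in> ob X
               then hom X (foldr (mul X) xs (unt X)) y else undefined)\<rparr>"

text \<open>A full subcategory is given by its collection \<open>C\<close> of objects; its morphisms are all functors
  between members of \<open>C\<close>. Maps are total functions, compared only on the carrier of their
  domain.\<close>

definition injective_wrt ::
  "('u, 'v::comm_quantale) lvcat set \<Rightarrow>
    (('u, 'v) lvcat \<Rightarrow> ('u, 'v) lvcat \<Rightarrow> ('u \<Rightarrow> 'u) \<Rightarrow> bool) \<Rightarrow> ('u, 'v) lvcat \<Rightarrow> bool"
  where "injective_wrt C J X \<longleftrightarrow>
    (\<forall>Y\<in>C. \<forall>Z\<in>C. \<forall>m h. lvfunctor Y Z m \<and> J Y Z m \<and> lvfunctor Y X h \<longrightarrow>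
      (\<exists>h'. lvfunctor Z X h' \<and> (\<forall>y\<in>lob Y. h' (m y) = h y)))"

end

theory Submission
  imports Defs
begin

text \<open>
  The functions \<open>L X \<rightarrow> V\<close> on the free monoid \<open>L X\<close> form a \<open>V\<close>-quantale under convolution, and
  \<open>x \<mapsto> a(-, x)\<close> embeds \<open>X\<close> fully faithfully into it; no presheaf condition on these functions is
  needed. If \<open>X\<close> is injective, this embedding has a retraction \<open>r\<close>, and products and colimits in
  \<open>X\<close> are computed by applying \<open>r\<close> to those of the larger \<open>V\<close>-quantale. Conversely, a functor
  \<open>h : Y \<rightarrow> Q\<close> into a \<open>V\<close>-quantale is extended along \<open>m : Y \<rightarrow> Z\<close> by the Kan extension formula: the
  value at \<open>z\<close> is the colimit of the products \<open>h(y\<^sub>1) \<cdots> h(y\<^sub>n)\<close> weighted by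
  \<open>Z((m(y\<^sub>1), \<dots>, m(y\<^sub>n)), z)\<close>.
\<close>

section \<open>Quantales and enriched categories\<close>

declare in_listsD [rule del] in_listsI [rule del] in_lists_conv_set [simp del]

lemma map_in_lists: "(\<And>x. x \<in> A \<Longrightarrow> f x \<in> B) \<Longrightarrow> xs \<in> lists A \<Longrightarrow> map f xs \<in> lists B"
  by (auto simp: in_lists_conv_set)

lemma concat_in_lists: "xss \<in> lists (lists A) \<Longrightarrow> concat xss \<in> lists A"
  by (auto simp: in_lists_conv_set)

lemma mult_mono_quantale:
  fixes a b c d :: "'v::comm_quantale"
  assumes "a \<le> b" "c \<le> d"
  shows "a * c \<le> b * d"
  by (metis assms mult.commute mult_left_mono_quantale order_trans)

lemma mult_SUP_le_iff:
  fixes u w :: "'v::comm_quantale"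
  shows "u * (SUP i\<in>I. f i) \<le> w \<longleftrightarrow> (\<forall>i\<in>I. u * f i \<le> w)"
  by (simp add: qhom_adjoint SUP_le_iff)

lemma SUP_mult_le_iff:
  fixes u w :: "'v::comm_quantale"
  shows "(SUP i\<in>I. f i) * u \<le> w \<longleftrightarrow> (\<forall>i\<in>I. f i * u \<le> w)"
  using mult_SUP_le_iff[of u f I w] by (simp add: mult.commute)

lemma bot_mult_le:
  fixes u w :: "'v::comm_quantale"
  shows "bot * u \<le> w"
  using SUP_mult_le_iff[of id "{}" u w] by simp

text \<open>Homs built from infima and residuals are awkward to compare directly, but by adjunction
  their lower bounds amount to inequalities between products. Equalities of homs are proved through
  these.\<close>

lemma eq_if_same_lower_bounds:
  fixes a b :: "'v::order"
  assumes "\<And>v. v \<le> a \<longleftrightarrow> v \<le> b"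
  shows "a = b"
  by (metis assms order_antisym order_refl)

lemma hom_refl: "is_vcat X \<Longrightarrow> x \<in> ob X \<Longrightarrow> 1 \<le> hom X x x"
  by (simp add: is_vcat_def)

lemma hom_trans_le:
  assumes "is_vcat X" "x \<in> ob X" "y \<in> ob X" "z \<in> ob X" "a \<le> hom X x y" "b \<le> hom X y z"
  shows "a * b \<le> hom X x z"
  by (meson assms is_vcat_def mult_mono_quantale order_trans)

text \<open>Yoneda: \<open>z = y\<close> and \<open>z = x\<close> turn the two identities into
  comparisons of \<open>x\<close> and \<open>y\<close> in both directions.\<close>

lemma vseparated_eqI:
  assumes "is_vcat X" "vseparated X" "x \<in> ob X" "y \<in> ob X"
    and "\<And>z. z \<in> ob X \<Longrightarrow> hom X x z = hom X y z"
  shows "x = y"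
  using assms by (metis hom_refl vle_def vseparated_def)

lemma is_weight_comp:
  assumes "is_weight S X A f \<phi>" "vfunctor X Y g"
  shows "is_weight S Y A (g \<circ> f) \<phi>"
proof -
  have f: "f \<in> ob A \<rightarrow> ob X" "\<And>s s'. s \<in> ob A \<Longrightarrow> s' \<in> ob A \<Longrightarrow> hom A s s' \<le> hom X (f s) (f s')"
    using assms(1) by (auto simp: is_weight_def vfunctor_def)
  have g: "g \<in> ob X \<rightarrow> ob Y" "\<And>x x'. x \<in> ob X \<Longrightarrow> x' \<in> ob X \<Longrightarrow> hom X x x' \<le> hom Y (g x) (g x')"
    using assms(2) by (auto simp: vfunctor_def)
  have "hom A s s' \<le> hom Y (g (f s)) (g (f s'))" if "s \<in> ob A" "s' \<in> ob A" for s s'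
    using f(2)[OF that] g(2)[of "f s" "f s'"] f(1) that by (meson PiE order_trans)
  then have "vfunctor A Y (g \<circ> f)"
    using f(1) g(1) by (auto simp: vfunctor_def Pi_iff)
  then show ?thesis
    using assms(1) by (simp add: is_weight_def)
qed

lemma le_INF_qhom_iff:
  fixes v :: "'v::comm_quantale"
  shows "v \<le> (INF s\<in>I. qhom (f s) (g s)) \<longleftrightarrow> (\<forall>s\<in>I. f s * v \<le> g s)"
  by (simp add: le_INF_iff qhom_adjoint)

text \<open>This is the identity of \<open>c\<close>, transposed through the colimit formula at
  \<open>y = c\<close>.\<close>

lemma colimit_cocone:
  assumes "is_vcat X" "is_colimit X A f \<phi> c" "s \<in> ob A"
  shows "\<phi> s \<le> hom X (f s) c"
proof -
  have "1 \<le> (INF s\<in>ob A. qhom (\<phi> s) (hom X (f s) c))"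
    using assms by (metis hom_refl is_colimit_def)
  then show ?thesis
    using assms(3) by (simp add: le_INF_qhom_iff)
qed

text \<open>A right adjoint is asked for on objects only: functoriality of \<open>g\<close> follows
  by composing with the unit, and the colimit formula at \<open>y\<close> is the given one at the
  transposed object \<open>y'\<close>.\<close>

lemma cocontinuous_left_adjoint:
  assumes X: "is_vcat X" and Y: "is_vcat Y" and g: "g \<in> ob X \<rightarrow> ob Y"
    and adj: "\<And>y. y \<in> ob Y \<Longrightarrow> \<exists>y'\<in>ob X. \<forall>x\<in>ob X. hom Y (g x) y = hom X x y'"
  shows "cocontinuous S X Y g"
  unfolding cocontinuous_def
proof (intro conjI allI impI)
  show "vfunctor X Y g"
    unfolding vfunctor_def
  proof (intro conjI ballI g)
    fix x x' assume x: "x \<in> ob X" "x' \<in> ob X"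
    then obtain y' where y': "y' \<in> ob X" "\<forall>x\<in>ob X. hom Y (g x) (g x') = hom X x y'"
      using adj[of "g x'"] g by blast
    \<comment> \<open>The unit of the adjunction, as the transpose of the identity on
      \<open>g x'\<close>.\<close>
    have "1 \<le> hom X x' y'"
      using y' x g hom_refl[OF Y, of "g x'"] by auto
    then show "hom X x x' \<le> hom Y (g x) (g x')"
      using hom_trans_le[OF X x y'(1) order_refl] y' x by fastforce
  qed
next
  fix A f \<phi> c assume "is_weight S X A f \<phi> \<and> is_colimit X A f \<phi> c"
  then have f: "f \<in> ob A \<rightarrow> ob X" and c: "c \<in> ob X"
    and colim: "\<And>y. y \<in> ob X \<Longrightarrow> hom X c y = (INF s\<in>ob A. qhom (\<phi> s) (hom X (f s) y))"
    by (auto simp: is_weight_def is_colimit_def vfunctor_def)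
  show "is_colimit Y A (g \<circ> f) \<phi> (g c)"
    unfolding is_colimit_def
  proof (intro conjI ballI)
    show "g c \<in> ob Y" using c g by auto
    fix y assume "y \<in> ob Y"
    then obtain y' where y': "y' \<in> ob X" "\<forall>x\<in>ob X. hom Y (g x) y = hom X x y'"
      using adj by blast
    then show "hom Y (g c) y = (INF s\<in>ob A. qhom (\<phi> s) (hom Y ((g \<circ> f) s) y))"
      using colim[OF y'(1)] c f by (simp add: Pi_iff)
  qed
qed


section \<open>Products of lists\<close>

abbreviation mprod :: "('a, 'v) mvcat \<Rightarrow> 'a list \<Rightarrow> 'a"
  where "mprod Q xs \<equiv> foldr (mul Q) xs (unt Q)"

lemma mvcatD:
  assumes "is_mvcat Q"
  shows mvcat_vcat: "is_vcat Q"
    and unt_ob: "unt Q \<in> ob Q"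
    and mul_unt_left: "x \<in> ob Q \<Longrightarrow> mul Q (unt Q) x = x"
    and mul_unt_right: "x \<in> ob Q \<Longrightarrow> mul Q x (unt Q) = x"
    and mul_ob: "x \<in> ob Q \<Longrightarrow> y \<in> ob Q \<Longrightarrow> mul Q x y \<in> ob Q"
    and mul_assoc: "x \<in> ob Q \<Longrightarrow> y \<in> ob Q \<Longrightarrow> z \<in> ob Q \<Longrightarrow>
      mul Q (mul Q x y) z = mul Q x (mul Q y z)"
  using assms by (auto simp: is_mvcat_def vfunctor_def vtensor_def Pi_iff)

lemma mprod_ob:
  assumes "is_mvcat Q" "xs \<in> lists (ob Q)"
  shows "mprod Q xs \<in> ob Q"
  using assms(2) by induction (auto simp: mvcatD[OF assms(1)])

lemma mprod_append:
  assumes "is_mvcat Q" "xs \<in> lists (ob Q)" "ys \<in> lists (ob Q)"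
  shows "mprod Q (xs @ ys) = mul Q (mprod Q xs) (mprod Q ys)"
  using assms(2)
proof induction
  case Nil
  then show ?case using mprod_ob[OF assms(1,3)] by (simp add: mvcatD[OF assms(1)])
next
  case (Cons x xs)
  then show ?case
    using mprod_ob[OF assms(1,3)] mprod_ob[OF assms(1) Cons(2)]
    by (simp add: mvcatD[OF assms(1)])
qed


section \<open>Substitution in \<open>(L,V)\<close>-categories\<close>

lemma lvcat_comp:
  assumes "is_lvcat X" "xss \<in> lists (lists (lob X))" "ys \<in> lists (lob X)" "z \<in> lob X"
    and "length xss = length ys"
  shows "prod_list (map2 (lhom X) xss ys) * lhom X ys z \<le> lhom X (concat xss) z"
  using assms by (simp add: is_lvcat_def)

lemma one_le_prod_singletons:
  assumes "is_lvcat X" "xs \<in> lists (lob X)"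
  shows "1 \<le> prod_list (map2 (lhom X) (map (\<lambda>x. [x]) xs) xs)"
  using assms(2)
proof induction
  case (Cons x xs)
  have "1 \<le> lhom X [x] x" using assms(1) Cons(1) by (simp add: is_lvcat_def)
  from mult_mono_quantale[OF this Cons(3)] show ?case by simp
qed simp

text \<open>Identities are inserted at every entry other than \<open>y\<close>; this reduces
  simultaneous composition to composition in one place, as in a multicategory.\<close>

lemma lvcat_subst:
  assumes X: "is_lvcat X" and xs: "xs \<in> lists (lob X)" and ys: "ys \<in> lists (lob X)"
    and zs: "zs \<in> lists (lob X)" and y: "y \<in> lob X" and z: "z \<in> lob X"
  shows "lhom X ys y * lhom X (xs @ y # zs) z \<le> lhom X (xs @ ys @ zs) z"
proof -
  let ?s = "map (\<lambda>x. [x])"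
  let ?p = "\<lambda>xs. prod_list (map2 (lhom X) (?s xs) xs)"
  have "1 * (lhom X ys y * 1) \<le> ?p xs * (lhom X ys y * ?p zs)"
    by (intro mult_mono_quantale order_refl one_le_prod_singletons X xs zs)
  also have "\<dots> = prod_list (map2 (lhom X) (?s xs @ ys # ?s zs) (xs @ y # zs))"
    by simp
  finally have "lhom X ys y * lhom X (xs @ y # zs) z
      \<le> prod_list (map2 (lhom X) (?s xs @ ys # ?s zs) (xs @ y # zs)) * lhom X (xs @ y # zs) z"
    by (intro mult_mono_quantale) simp_all
  also have "\<dots> \<le> lhom X (concat (?s xs @ ys # ?s zs)) z"
    by (rule lvcat_comp[OF X]) (use xs ys zs y z in \<open>auto simp: in_lists_conv_set\<close>)
  finally show ?thesis by simp
qed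

lemma lvseparated_eqI:
  assumes "is_lvcat X" "lvseparated X" "x \<in> lob X" "y \<in> lob X"
    and "\<And>z. z \<in> lob X \<Longrightarrow> lhom X [x] z = lhom X [y] z"
  shows "x = y"
  using assms unfolding lvseparated_def is_lvcat_def by metis


lemma lvfunctorD:
  assumes "lvfunctor X Y f"
  shows lvfunctor_lob: "x \<in> lob X \<Longrightarrow> f x \<in> lob Y"
    and lvfunctor_lhom: "xs \<in> lists (lob X) \<Longrightarrow> y \<in> lob X \<Longrightarrow>
      lhom X xs y \<le> lhom Y (map f xs) (f y)"
  using assms unfolding lvfunctor_def by blast+

lemma lob_Kmp [simp]: "lob (Kmp Q) = ob Q"
  by (simp add: Kmp_def)

lemma lhom_Kmp: "xs \<in> lists (ob Q) \<Longrightarrow> y \<in> ob Q \<Longrightarrow> lhom (Kmp Q) xs y = hom Q (mprod Q xs) y"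
  unfolding Kmp_def by (simp only: lvcat.simps if_True simp_thms)


section \<open>The quantale of functions on a free monoid\<close>

text \<open>The functions are encoded in an arbitrary type by an injection \<open>e\<close>, because the objects of all
  categories considered have to live in one type.\<close>

locale function_encoding =
  fixes M :: "'a set" and e :: "('a list \<Rightarrow> 'v::comm_quantale) \<Rightarrow> 'u"
  assumes inj_e: "inj_on e (lists M \<rightarrow>\<^sub>E UNIV)"
begin

text \<open>\<open>e\<close> is injective only on functions that are \<open>undefined\<close> off
  \<open>lists M\<close>, hence the restriction before encoding.\<close>

definition enc :: "('a list \<Rightarrow> 'v) \<Rightarrow> 'u"
  where "enc g = e (restrict g (lists M))"

definition dec :: "'u \<Rightarrow> 'a list \<Rightarrow> 'v"
  where "dec = inv_into (lists M \<rightarrow>\<^sub>E UNIV) e"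

text \<open>The \<open>V\<close>-category of presheaves on the discrete free monoid, with Day
  convolution along concatenation.\<close>

definition fq :: "('u, 'v) mvcat"
  where "fq =
    \<lparr>ob = range enc,
     hom = (\<lambda>u v. INF ws\<in>lists M. qhom (dec u ws) (dec v ws)),
     mul = (\<lambda>u v. enc (\<lambda>ws. SUP (us, vs)\<in>{(us, vs). us @ vs = ws}. dec u us * dec v vs)),
     unt = enc (\<lambda>ws. if ws = [] then 1 else bot)\<rparr>"

lemma dec_enc: "ws \<in> lists M \<Longrightarrow> dec (enc g) ws = g ws"
  unfolding dec_def enc_def by (subst inv_into_f_f[OF inj_e]) auto

lemma enc_in_ob [simp]: "enc g \<in> ob fq"
  by (simp add: fq_def)

lemma ob_fq_subset: "ob fq \<subseteq> e ` (lists M \<rightarrow>\<^sub>E UNIV)"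
  by (auto simp: fq_def enc_def)

lemma mul_in_ob [simp]: "mul fq u v \<in> ob fq"
  by (simp add: fq_def)

lemma unt_in_ob [simp]: "unt fq \<in> ob fq"
  by (simp add: fq_def)

lemma ob_eqI:
  assumes "u \<in> ob fq" "v \<in> ob fq" "\<And>ws. ws \<in> lists M \<Longrightarrow> dec u ws = dec v ws"
  shows "u = v"
proof -
  from assms obtain g h where gh: "u = enc g" "v = enc h" by (auto simp: fq_def)
  have "restrict g (lists M) = restrict h (lists M)"
    using assms(3) by (intro restrict_ext) (simp add: gh dec_enc)
  then show ?thesis by (simp add: gh enc_def)
qed

section \<open>Hom, convolution and unit, characterised by lower bounds\<close>

lemma le_hom_iff: "v \<le> hom fq u w \<longleftrightarrow> (\<forall>ws\<in>lists M. dec u ws * v \<le> dec w ws)"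
  by (simp add: fq_def le_INF_qhom_iff)

text \<open>Convolution is a supremum over splittings. The weight \<open>a\<close> and the bound
  \<open>b\<close> vary with the list so that the rule also applies to one factor of a longer
  product, with the other factors absorbed in \<open>a\<close> and the shift by their lists in
  \<open>b\<close>.\<close>

lemma dec_mul_le_iff:
  "(\<forall>ws\<in>lists M. dec (mul fq u w) ws * a ws \<le> b ws) \<longleftrightarrow>
    (\<forall>us\<in>lists M. \<forall>vs\<in>lists M. dec u us * dec w vs * a (us @ vs) \<le> b (us @ vs))"
  (is "?l \<longleftrightarrow> ?r")
proof -
  have "?l \<longleftrightarrow> (\<forall>ws\<in>lists M. \<forall>us vs. us @ vs = ws \<longrightarrow> dec u us * dec w vs * a ws \<le> b ws)"
    by (auto simp: fq_def dec_enc SUP_mult_le_iff)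
  also have "\<dots> \<longleftrightarrow> ?r"
    by auto
  finally show ?thesis .
qed

text \<open>Away from \<open>[]\<close> the unit is \<open>bot\<close>, so the condition is void
  there.\<close>

lemma dec_unt_le_iff:
  "(\<forall>ws\<in>lists M. dec (unt fq) ws * a ws \<le> b ws) \<longleftrightarrow> a [] \<le> b []"
  by (auto simp: fq_def dec_enc bot_mult_le)

lemma le_hom_mul_iff:
  "v \<le> hom fq (mul fq u w) x \<longleftrightarrow>
    (\<forall>us\<in>lists M. \<forall>vs\<in>lists M. dec u us * dec w vs * v \<le> dec x (us @ vs))"
  unfolding le_hom_iff by (rule dec_mul_le_iff)

lemma dec_mult_hom_le: "ws \<in> lists M \<Longrightarrow> dec u ws * hom fq u w \<le> dec w ws"
  using le_hom_iff[of "hom fq u w" u w] by simp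

lemma is_vcat_fq: "is_vcat fq"
  unfolding is_vcat_def
proof (intro conjI ballI)
  fix x y z
  have 1: "dec x ws * hom fq x y \<le> dec y ws" "dec y ws * hom fq y z \<le> dec z ws"
    if "ws \<in> lists M" for ws
    using that by (rule dec_mult_hom_le)+
  have "dec x ws * (hom fq x y * hom fq y z) \<le> dec z ws" if "ws \<in> lists M" for ws
    using order_trans[OF mult_mono_quantale[OF 1(1)[OF that] order_refl] 1(2)[OF that]]
    by (simp add: mult.assoc)
  then show "hom fq x y * hom fq y z \<le> hom fq x z"
    by (simp add: le_hom_iff)
qed (simp add: le_hom_iff)

lemma vseparated_fq: "vseparated fq"
  unfolding vseparated_def vle_def
  by (auto simp: le_hom_iff intro!: ob_eqI order_antisym)

text \<open>Homs out of either bracketing have the same lower bounds: both unfold to one condition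
  on all triples of lists, by associativity of concatenation.\<close>

lemma mul_fq_assoc: "mul fq (mul fq x y) z = mul fq x (mul fq y z)"
proof (rule vseparated_eqI[OF is_vcat_fq vseparated_fq])
  fix w
  show "hom fq (mul fq (mul fq x y) z) w = hom fq (mul fq x (mul fq y z)) w"
  proof (rule eq_if_same_lower_bounds)
    fix v
    have "v \<le> hom fq (mul fq (mul fq x y) z) w \<longleftrightarrow>
      (\<forall>ts\<in>lists M. \<forall>us\<in>lists M. dec (mul fq x y) us * (dec z ts * v) \<le> dec w (us @ ts))"
      unfolding le_hom_mul_iff by (auto simp: mult.assoc)
    also have "\<dots> \<longleftrightarrow> (\<forall>ts\<in>lists M. \<forall>us\<in>lists M. \<forall>vs\<in>lists M.
        dec x us * dec y vs * dec z ts * v \<le> dec w (us @ vs @ ts))"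
      by (subst dec_mul_le_iff) (simp add: mult.assoc)
    also have "\<dots> \<longleftrightarrow> (\<forall>us\<in>lists M. \<forall>vs\<in>lists M. \<forall>ts\<in>lists M.
        dec y vs * dec z ts * (dec x us * v) \<le> dec w (us @ vs @ ts))"
      by (auto simp: ac_simps)
    also have "\<dots> \<longleftrightarrow> (\<forall>us\<in>lists M. \<forall>vs\<in>lists M.
        dec (mul fq y z) vs * (dec x us * v) \<le> dec w (us @ vs))"
      by (subst dec_mul_le_iff) simp
    also have "\<dots> \<longleftrightarrow> v \<le> hom fq (mul fq x (mul fq y z)) w"
      unfolding le_hom_mul_iff by (simp add: ac_simps)
    finally show "v \<le> hom fq (mul fq (mul fq x y) z) w \<longleftrightarrow>
      v \<le> hom fq (mul fq x (mul fq y z)) w" .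
  qed
qed simp_all

lemma mul_fq_unt_left:
  assumes "x \<in> ob fq"
  shows "mul fq (unt fq) x = x"
proof (rule vseparated_eqI[OF is_vcat_fq vseparated_fq])
  fix w
  show "hom fq (mul fq (unt fq) x) w = hom fq x w"
  proof (rule eq_if_same_lower_bounds)
    fix v
    have "v \<le> hom fq (mul fq (unt fq) x) w \<longleftrightarrow>
      (\<forall>vs\<in>lists M. \<forall>us\<in>lists M. dec (unt fq) us * (dec x vs * v) \<le> dec w (us @ vs))"
      unfolding le_hom_mul_iff by (auto simp: mult.assoc)
    also have "\<dots> \<longleftrightarrow> v \<le> hom fq x w"
      by (subst dec_unt_le_iff) (simp add: le_hom_iff)
    finally show "v \<le> hom fq (mul fq (unt fq) x) w \<longleftrightarrow> v \<le> hom fq x w" .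
  qed
qed (use assms in simp_all)

lemma mul_fq_unt_right:
  assumes "x \<in> ob fq"
  shows "mul fq x (unt fq) = x"
proof (rule vseparated_eqI[OF is_vcat_fq vseparated_fq])
  fix w
  show "hom fq (mul fq x (unt fq)) w = hom fq x w"
  proof (rule eq_if_same_lower_bounds)
    fix v
    have "v \<le> hom fq (mul fq x (unt fq)) w \<longleftrightarrow>
      (\<forall>us\<in>lists M. \<forall>vs\<in>lists M. dec (unt fq) vs * (dec x us * v) \<le> dec w (us @ vs))"
      unfolding le_hom_mul_iff by (simp add: ac_simps)
    also have "\<dots> \<longleftrightarrow> v \<le> hom fq x w"
      by (subst dec_unt_le_iff) (simp add: le_hom_iff)
    finally show "v \<le> hom fq (mul fq x (unt fq)) w \<longleftrightarrow> v \<le> hom fq x w" .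
  qed
qed (use assms in simp_all)

lemma is_mvcat_fq: "is_mvcat fq"
proof -
  have "hom fq x x' * hom fq y y' \<le> hom fq (mul fq x y) (mul fq x' y')" for x x' y y'
    unfolding le_hom_mul_iff
  proof (intro ballI)
    fix us vs assume M: "us \<in> lists M" "vs \<in> lists M"
    have "dec x us * hom fq x x' * (dec y vs * hom fq y y') \<le> dec x' us * dec y' vs"
      using M by (intro mult_mono_quantale dec_mult_hom_le)
    \<comment> \<open>\<open>dec_mul_le_iff\<close> with \<open>a\<close> constantly 1 and the
      convolution itself as bound: a single splitting lies below the supremum.\<close>
    also have "\<dots> \<le> dec (mul fq x' y') (us @ vs)"
      using dec_mul_le_iff[of x' y' "\<lambda>_. 1" "dec (mul fq x' y')"] M by simp
    finally show "dec x us * dec y vs * (hom fq x x' * hom fq y y')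
        \<le> dec (mul fq x' y') (us @ vs)"
      by (simp add: ac_simps)
  qed
  then show ?thesis
    by (auto simp: is_mvcat_def is_vcat_fq mul_fq_unt_left mul_fq_unt_right mul_fq_assoc
        vfunctor_def vtensor_def)
qed

text \<open>Colimits are computed pointwise, as weighted suprema in \<open>V\<close>.\<close>

lemma cocomplete_fq: "cocomplete S fq"
  unfolding cocomplete_def
proof (intro allI impI exI)
  fix A :: "('u, 'v) vcat" and f \<phi>
  define c where "c = enc (\<lambda>ws. SUP s\<in>ob A. \<phi> s * dec (f s) ws)"
  have "v \<le> hom fq c y \<longleftrightarrow> v \<le> (INF s\<in>ob A. qhom (\<phi> s) (hom fq (f s) y))" for v y
    unfolding le_INF_qhom_iff le_hom_iff
    by (auto simp: c_def dec_enc SUP_mult_le_iff mult_SUP_le_iff ac_simps)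
  then have "hom fq c y = (INF s\<in>ob A. qhom (\<phi> s) (hom fq (f s) y))" for y
    by (rule eq_if_same_lower_bounds)
  then show "is_colimit fq A f \<phi> c"
    by (simp add: is_colimit_def c_def)
qed

text \<open>Multiplication on either side has a right adjoint on objects, the residual
  \<open>y'\<close> of convolution, and is therefore cocontinuous.\<close>

lemma vquantale_fq: "vquantale S fq"
  unfolding vquantale_def
proof (intro conjI ballI is_mvcat_fq vseparated_fq cocomplete_fq)
  fix x
  show "cocontinuous S fq fq (\<lambda>y. mul fq x y)"
  proof (rule cocontinuous_left_adjoint[OF is_vcat_fq is_vcat_fq])
    fix y
    define y' where "y' = enc (\<lambda>vs. INF us\<in>lists M. qhom (dec x us) (dec y (us @ vs)))"
    have "v \<le> hom fq (mul fq x z) y \<longleftrightarrow> v \<le> hom fq z y'" for v z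
      unfolding le_hom_mul_iff unfolding le_hom_iff
      by (auto simp: y'_def dec_enc le_INF_qhom_iff mult.assoc)
    then have "hom fq (mul fq x z) y = hom fq z y'" for z
      by (rule eq_if_same_lower_bounds)
    then show "\<exists>y'\<in>ob fq. \<forall>z\<in>ob fq. hom fq (mul fq x z) y = hom fq z y'"
      by (intro bexI[of _ y'] ballI) (simp_all add: y'_def)
  qed simp
  show "cocontinuous S fq fq (\<lambda>y. mul fq y x)"
  proof (rule cocontinuous_left_adjoint[OF is_vcat_fq is_vcat_fq])
    fix y
    define y' where "y' = enc (\<lambda>us. INF vs\<in>lists M. qhom (dec x vs) (dec y (us @ vs)))"
    have "v \<le> hom fq (mul fq z x) y \<longleftrightarrow> v \<le> hom fq z y'" for v z
      unfolding le_hom_mul_iff unfolding le_hom_iff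
      by (auto simp: y'_def dec_enc le_INF_qhom_iff ac_simps)
    then have "hom fq (mul fq z x) y = hom fq z y'" for z
      by (rule eq_if_same_lower_bounds)
    then show "\<exists>y'\<in>ob fq. \<forall>z\<in>ob fq. hom fq (mul fq z x) y = hom fq z y'"
      by (intro bexI[of _ y'] ballI) (simp_all add: y'_def)
  qed simp
qed

section \<open>The embedding of an \<open>(L,V)\<close>-category into the functions\<close>

definition yoneda :: "('a, 'v) lvcat \<Rightarrow> 'a \<Rightarrow> 'u"
  where "yoneda X x = enc (\<lambda>ws. lhom X ws x)"

lemma yoneda_in_ob [simp]: "yoneda X x \<in> ob fq"
  by (simp add: yoneda_def)

text \<open>Iterating \<open>dec_mul_le_iff\<close> splits a list into one piece per factor. The
  induction varies \<open>a\<close> and \<open>b\<close>, because the tail is used with both shifted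
  by the first piece \<open>us\<close>.\<close>

lemma dec_mprod_yoneda_le_iff:
  "(\<forall>ws\<in>lists M. dec (mprod fq (map (yoneda X) xs)) ws * a ws \<le> b ws) \<longleftrightarrow>
    (\<forall>wss\<in>lists (lists M). length wss = length xs \<longrightarrow>
      prod_list (map2 (lhom X) wss xs) * a (concat wss) \<le> b (concat wss))"
proof (induction xs arbitrary: a b)
  case Nil
  then show ?case using dec_unt_le_iff[of a b] by auto
next
  case (Cons x xs)
  let ?p = "mprod fq (map (yoneda X) xs)"
  have "(\<forall>ws\<in>lists M. dec (mprod fq (map (yoneda X) (x # xs))) ws * a ws \<le> b ws) \<longleftrightarrow>
    (\<forall>us\<in>lists M. \<forall>vs\<in>lists M. dec ?p vs * (lhom X us x * a (us @ vs)) \<le> b (us @ vs))"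
    using dec_mul_le_iff[of "yoneda X x" ?p a b] by (simp add: yoneda_def dec_enc ac_simps)
  also have "\<dots> \<longleftrightarrow> (\<forall>us\<in>lists M. \<forall>wss\<in>lists (lists M). length wss = length xs \<longrightarrow>
      prod_list (map2 (lhom X) (us # wss) (x # xs)) * a (concat (us # wss))
        \<le> b (concat (us # wss)))"
    by (subst Cons.IH) (simp add: ac_simps)
  also have "\<dots> \<longleftrightarrow> (\<forall>wss\<in>lists (lists M). length wss = length (x # xs) \<longrightarrow>
      prod_list (map2 (lhom X) wss (x # xs)) * a (concat wss) \<le> b (concat wss))"
    (is "?l \<longleftrightarrow> ?r")
  proof
    assume l: ?l
    show ?r
    proof (intro ballI impI)
      fix wss assume w: "wss \<in> lists (lists M)" "length wss = length (x # xs)"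
      then obtain us wss' where eq: "wss = us # wss'" by (cases wss) auto
      show "prod_list (map2 (lhom X) wss (x # xs)) * a (concat wss) \<le> b (concat wss)"
        using l w unfolding eq by auto
    qed
  next
    assume r: ?r
    show ?l
    proof (intro ballI impI)
      fix us wss assume w: "us \<in> lists M" "wss \<in> lists (lists M)" "length wss = length xs"
      show "prod_list (map2 (lhom X) (us # wss) (x # xs)) * a (concat (us # wss))
        \<le> b (concat (us # wss))"
        by (rule r[rule_format]) (use w in auto)
    qed
  qed
  finally show ?case .
qed

text \<open>Taking the lists \<open>wss\<close> to be singletons bounds the hom in \<open>fq\<close>
  by the structure of \<open>X\<close>; the composition law of \<open>X\<close>, for arbitrary
  \<open>wss\<close>, gives the converse.\<close>

lemma fully_faithful_yoneda:
  assumes X: "is_lvcat X" and M: "lob X = M"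
  shows "fully_faithful X (Kmp fq) (yoneda X)"
proof -
  have *: "hom fq (mprod fq (map (yoneda X) xs)) (yoneda X z) = lhom X xs z"
    if xs: "xs \<in> lists M" and z: "z \<in> M" for xs z
  proof (rule eq_if_same_lower_bounds)
    fix v
    have concat: "concat wss \<in> lists M" if "wss \<in> lists (lists M)" for wss
      using that by (rule concat_in_lists)
    have "v \<le> hom fq (mprod fq (map (yoneda X) xs)) (yoneda X z) \<longleftrightarrow>
      (\<forall>wss\<in>lists (lists M). length wss = length xs \<longrightarrow>
        prod_list (map2 (lhom X) wss xs) * v \<le> dec (yoneda X z) (concat wss))"
      unfolding le_hom_iff by (rule dec_mprod_yoneda_le_iff)
    also have "\<dots> \<longleftrightarrow> (\<forall>wss\<in>lists (lists M). length wss = length xs \<longrightarrow>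
        prod_list (map2 (lhom X) wss xs) * v \<le> lhom X (concat wss) z)"
      using concat by (auto simp: yoneda_def dec_enc)
    also have "\<dots> \<longleftrightarrow> v \<le> lhom X xs z"
    proof
      assume *: "\<forall>wss\<in>lists (lists M). length wss = length xs \<longrightarrow>
        prod_list (map2 (lhom X) wss xs) * v \<le> lhom X (concat wss) z"
      have "1 * v \<le> prod_list (map2 (lhom X) (map (\<lambda>x. [x]) xs) xs) * v"
        using one_le_prod_singletons[OF X] xs M by (intro mult_mono_quantale) auto
      also have "\<dots> \<le> lhom X (concat (map (\<lambda>x. [x]) xs)) z"
        by (rule *[rule_format]) (use xs in \<open>auto simp: in_lists_conv_set\<close>)
      finally show "v \<le> lhom X xs z" by simp
    next
      assume v: "v \<le> lhom X xs z"
      show "\<forall>wss\<in>lists (lists M). length wss = length xs \<longrightarrow>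
        prod_list (map2 (lhom X) wss xs) * v \<le> lhom X (concat wss) z"
        using lvcat_comp[OF X _ _ _, of _ xs z] xs z M mult_left_mono_quantale[OF v] order_trans
        by blast
    qed
    finally show "v \<le> hom fq (mprod fq (map (yoneda X) xs)) (yoneda X z) \<longleftrightarrow> v \<le> lhom X xs z" .
  qed
  then have "lhom (Kmp fq) (map (yoneda X) xs) (yoneda X z) = lhom X xs z"
    if "xs \<in> lists M" "z \<in> M" for xs z
    using that lhom_Kmp[of "map (yoneda X) xs" fq] by (auto simp: in_lists_conv_set)
  then show ?thesis
    by (auto simp: fully_faithful_def lvfunctor_def M)
qed

end


section \<open>Retracts of \<open>V\<close>-quantales\<close>

text \<open>The product of a list in \<open>X\<close> is \<open>r\<close> of its product in
  \<open>Q\<close>. It has the same homs out as the list itself, in every context, so by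
  separatedness the monoid laws reduce to equalities of homs in \<open>X\<close>, which
  \<open>i\<close> and \<open>r\<close> relate to homs in \<open>Q\<close>. Colimits are treated
  likewise.\<close>

lemma retract_vquantale:
  assumes Q: "vquantale S Q" and X: "is_lvcat X" and sep: "lvseparated X"
    and i: "fully_faithful X (Kmp Q) i" and r: "lvfunctor (Kmp Q) X r"
    and ri: "\<And>x. x \<in> lob X \<Longrightarrow> r (i x) = x"
  shows "\<exists>R. vquantale S R \<and> X = Kmp R"
proof -
  have Qm: "is_mvcat Q" and Qc: "cocomplete S Q"
    and Qcc: "\<And>x. x \<in> ob Q \<Longrightarrow> cocontinuous S Q Q (\<lambda>y. mul Q x y)"
      "\<And>x. x \<in> ob Q \<Longrightarrow> cocontinuous S Q Q (\<lambda>y. mul Q y x)"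
    using Q by (auto simp: vquantale_def)
  note Qv = mvcat_vcat[OF Qm]
  have iob: "i x \<in> ob Q" if "x \<in> lob X" for x
    using i that by (auto simp: fully_faithful_def lvfunctor_def Kmp_def)
  then have iobs: "map i xs \<in> lists (ob Q)" if "xs \<in> lists (lob X)" for xs
    using that by (intro map_in_lists)
  have rob: "r q \<in> lob X" if "q \<in> ob Q" for q
    using lvfunctor_lob[OF r] that by simp
  have homX: "lhom X xs z = hom Q (mprod Q (map i xs)) (i z)"
    if "xs \<in> lists (lob X)" "z \<in> lob X" for xs z
    using i that lhom_Kmp[OF iobs[OF that(1)] iob[OF that(2)]] unfolding fully_faithful_def
    by metis
  have hom_r: "hom Q (mprod Q qs) q \<le> lhom X (map r qs) (r q)"
    if "qs \<in> lists (ob Q)" "q \<in> ob Q" for qs q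
    using lvfunctor_lhom[OF r] that by (simp only: lob_Kmp lhom_Kmp)
  have map_ri: "map r (map i xs) = xs" if "xs \<in> lists (lob X)" for xs
    using that by induction (auto simp: ri)
  have homX1: "lhom X [x] z = hom Q (i x) (i z)" if "x \<in> lob X" "z \<in> lob X" for x z
    using homX[of "[x]" z] that iob[of x] by (simp add: mvcatD[OF Qm])

  \<comment> \<open>The monoid structure of the retract\<close>
  define t where "t xs = r (mprod Q (map i xs))" for xs
  have tob: "t xs \<in> lob X" if "xs \<in> lists (lob X)" for xs
    unfolding t_def by (intro rob mprod_ob Qm iobs that)
  \<comment> \<open>The universal arrow from a list to its product, obtained by applying
    \<open>r\<close> to the identity of the product in \<open>Q\<close>.\<close>
  have hom_t: "1 \<le> lhom X xs (t xs)" if "xs \<in> lists (lob X)" for xs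
    using hom_r[OF iobs[OF that] mprod_ob[OF Qm iobs[OF that]]] map_ri[OF that]
      hom_refl[OF Qv mprod_ob[OF Qm iobs[OF that]]] unfolding t_def by simp
  \<comment> \<open>One inequality composes with the universal arrow from \<open>ys\<close> to
    \<open>t ys\<close>. For the other, the block \<open>ys\<close> is multiplied out in
    \<open>Q\<close> first; \<open>r\<close> sends this block to \<open>t ys\<close> and the images
    of the remaining entries back to those entries.\<close>
  have t_subst: "lhom X (xs @ t ys # zs) z = lhom X (xs @ ys @ zs) z"
    if xs: "xs \<in> lists (lob X)" and ys: "ys \<in> lists (lob X)" and zs: "zs \<in> lists (lob X)"
      and z: "z \<in> lob X" for xs ys zs z
  proof (rule order_antisym)
    have "1 * lhom X (xs @ t ys # zs) z \<le> lhom X ys (t ys) * lhom X (xs @ t ys # zs) z"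
      by (intro mult_mono_quantale hom_t ys order_refl)
    also have "\<dots> \<le> lhom X (xs @ ys @ zs) z"
      by (intro lvcat_subst X xs ys zs tob z)
    finally show "lhom X (xs @ t ys # zs) z \<le> lhom X (xs @ ys @ zs) z" by simp
  next
    let ?p = "mprod Q (map i ys)"
    have p: "?p \<in> ob Q" by (intro mprod_ob Qm iobs ys)
    have "lhom X (xs @ ys @ zs) z = hom Q (mprod Q (map i xs @ map i ys @ map i zs)) (i z)"
      using homX[of "xs @ ys @ zs"] xs ys zs z by simp
    also have "mprod Q (map i xs @ map i ys @ map i zs) = mprod Q (map i xs @ ?p # map i zs)"
      using iobs[OF xs] iobs[OF ys] iobs[OF zs] p
      by (simp only: mprod_append[OF Qm] append_in_lists_conv Cons_in_lists_iff simp_thms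
          foldr.simps o_apply)
    also have "hom Q (mprod Q (map i xs @ ?p # map i zs)) (i z)
        \<le> lhom X (map r (map i xs @ ?p # map i zs)) (r (i z))"
      using iobs[OF xs] iobs[OF zs] p iob[OF z] by (intro hom_r) auto
    also have "\<dots> = lhom X (xs @ t ys # zs) z"
      using map_ri[OF xs] map_ri[OF zs] ri[OF z] by (simp add: t_def)
    finally show "lhom X (xs @ ys @ zs) z \<le> lhom X (xs @ t ys # zs) z" .
  qed
  have hom_t_eq: "lhom X [t ys] z = lhom X ys z" if "ys \<in> lists (lob X)" "z \<in> lob X" for ys z
    using t_subst[of "[]" ys "[]" z] that by simp
  have t_t: "t (xs @ t ys # zs) = t (xs @ ys @ zs)"
    if "xs \<in> lists (lob X)" "ys \<in> lists (lob X)" "zs \<in> lists (lob X)" for xs ys zs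
    using that tob[of ys]
    by (intro lvseparated_eqI[OF X sep] tob) (simp_all add: hom_t_eq t_subst)
  have t1: "t [x] = x" if "x \<in> lob X" for x
    using that by (intro lvseparated_eqI[OF X sep] tob) (simp_all add: hom_t_eq)

  define R where "R = \<lparr>ob = lob X, hom = (\<lambda>x y. lhom X [x] y), mul = (\<lambda>x y. t [x, y]), unt = t []\<rparr>"
  have R_sel [simp]: "ob R = lob X" "hom R = (\<lambda>x y. lhom X [x] y)" "mul R = (\<lambda>x y. t [x, y])"
      "unt R = t []"
    by (simp_all add: R_def)
  have Rv: "is_vcat R"
    unfolding is_vcat_def
  proof (intro conjI ballI)
    fix x assume "x \<in> ob R" then show "1 \<le> hom R x x" using X by (simp add: is_lvcat_def)
  next
    fix x y z assume "x \<in> ob R" "y \<in> ob R" "z \<in> ob R"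
    then show "hom R x y * hom R y z \<le> hom R x z"
      using lvcat_subst[OF X, of "[]" "[x]" "[]" y z] by simp
  qed
  have mprod_R: "mprod R xs = t xs" if "xs \<in> lists (lob X)" for xs
    using that
  proof induction
    case (Cons x xs)
    then show ?case using t_t[of "[x]" xs "[]"] by simp
  qed simp
  have Rm: "is_mvcat R"
    unfolding is_mvcat_def
  proof (intro conjI ballI Rv)
    show "unt R \<in> ob R" by (simp add: tob)
    fix x assume x: "x \<in> ob R"
    show "mul R (unt R) x = x" "mul R x (unt R) = x"
      using x t_t[of "[]" "[]" "[x]"] t_t[of "[x]" "[]" "[]"] t1 by simp_all
    fix y z assume y: "y \<in> ob R" and z: "z \<in> ob R"
    show "mul R (mul R x y) z = mul R x (mul R y z)"
      using x y z t_t[of "[]" "[x, y]" "[z]"] t_t[of "[x]" "[y, z]" "[]"] by simp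
  next
    have "lhom X [x] x' * lhom X [y] y' \<le> lhom X [t [x, y]] (t [x', y'])"
      if "x \<in> lob X" "y \<in> lob X" "x' \<in> lob X" "y' \<in> lob X" for x y x' y'
    proof -
      \<comment> \<open>The two arrows are substituted one at a time into the universal arrow from
        \<open>[x', y']\<close> to its product.\<close>
      let ?w = "t [x', y']"
      have w: "?w \<in> lob X" using that by (intro tob) auto
      have "lhom X [x] x' * (lhom X [y] y' * 1)
          \<le> lhom X [x] x' * (lhom X [y] y' * lhom X [x', y'] ?w)"
        using that by (intro mult_mono_quantale order_refl hom_t) auto
      also have "\<dots> \<le> lhom X [x] x' * lhom X [x', y] ?w"
        using lvcat_subst[OF X, of "[x']" "[y]" "[]" y' ?w] that w
        by (intro mult_mono_quantale order_refl) simp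
      also have "\<dots> \<le> lhom X [x, y] ?w"
        using lvcat_subst[OF X, of "[]" "[x]" "[y]" x' ?w] that w by simp
      also have "\<dots> = lhom X [t [x, y]] ?w"
        using that w by (simp add: hom_t_eq)
      finally show ?thesis by simp
    qed
    then show "vfunctor (vtensor R R) R (\<lambda>(x, y). mul R x y)"
      by (auto simp: vfunctor_def vtensor_def tob)
  qed
  have Rs: "vseparated R"
    using sep by (simp add: vseparated_def vle_def lvseparated_def)

  \<comment> \<open>Colimits in the retract\<close>
  have weight: "is_weight S Q A (i \<circ> f) \<phi>" if "is_weight S R A f \<phi>" for A f \<phi>
    using that by (auto simp: is_weight_def vfunctor_def iob homX1 Pi_iff)

  text \<open>Existence of colimits in \<open>R\<close> is the case \<open>xs = zs = []\<close>; preservation by multiplication from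
    the left and from the right are the cases of a singleton \<open>xs\<close> or \<open>zs\<close>.\<close>

  have key: "is_colimit R A (\<lambda>s. t (xs @ f s # zs)) \<phi> (t (xs @ r c # zs))"
    if w: "is_weight S R A f \<phi>" and c: "is_colimit Q A (i \<circ> f) \<phi> c"
      and xs: "xs \<in> lists (lob X)" and zs: "zs \<in> lists (lob X)" for A f \<phi> c xs zs
  proof -
    have f: "f s \<in> lob X" if "s \<in> ob A" for s
      using that w by (auto simp: is_weight_def vfunctor_def)
    have cob: "c \<in> ob Q" using c by (simp add: is_colimit_def)
    let ?a = "mprod Q (map i xs)" and ?b = "mprod Q (map i zs)"
    have a: "?a \<in> ob Q" and b: "?b \<in> ob Q" by (intro mprod_ob Qm iobs xs zs)+
    have prod: "mprod Q (map i xs @ q # map i zs) = mul Q ?a (mul Q q ?b)" if "q \<in> ob Q" for q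
      using iobs[OF xs] iobs[OF zs] that mprod_append[OF Qm iobs[OF xs], of "q # map i zs"]
      by simp
    have wb: "is_weight S Q A ((\<lambda>q. mul Q q ?b) \<circ> (i \<circ> f)) \<phi>"
      using Qcc(2)[OF b] by (intro is_weight_comp[OF weight[OF w]]) (simp add: cocontinuous_def)
    have "is_colimit Q A ((\<lambda>q. mul Q q ?b) \<circ> (i \<circ> f)) \<phi> (mul Q c ?b)"
      using Qcc(2)[OF b] weight[OF w] c unfolding cocontinuous_def by blast
    then have colim: "is_colimit Q A ((\<lambda>q. mul Q ?a q) \<circ> ((\<lambda>q. mul Q q ?b) \<circ> (i \<circ> f))) \<phi>
        (mul Q ?a (mul Q c ?b))"
      using Qcc(1)[OF a] wb unfolding cocontinuous_def by blast
    show ?thesis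
      unfolding is_colimit_def
    proof (intro conjI ballI)
      show "t (xs @ r c # zs) \<in> ob R" using xs zs cob by (simp add: tob rob)
      fix y assume "y \<in> ob R"
      then have y: "y \<in> lob X" by simp
      have eq: "hom R (t (xs @ x # zs)) y = lhom X (xs @ x # zs) y" if "x \<in> lob X" for x
        using that xs zs y by (simp add: hom_t_eq)
      have "lhom X (xs @ r c # zs) y = (INF s\<in>ob A. qhom (\<phi> s) (lhom X (xs @ f s # zs) y))"
      proof (rule order_antisym)
        have "\<phi> s * lhom X (xs @ r c # zs) y \<le> lhom X (xs @ f s # zs) y" if s: "s \<in> ob A" for s
        proof -
          \<comment> \<open>\<open>r\<close> maps the colimit cocone of \<open>Q\<close> to a cocone
            on \<open>r c\<close>, which is then composed with arrows out of
            \<open>xs @ r c # zs\<close>.\<close>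
          have "\<phi> s \<le> hom Q (i (f s)) c"
            using colimit_cocone[OF Qv c s] by simp
          also have "\<dots> \<le> lhom X [f s] (r c)"
            using hom_r[of "[i (f s)]" c] iob[OF f[OF s]] cob ri[OF f[OF s]]
            by (simp add: mvcatD[OF Qm])
          finally have "\<phi> s * lhom X (xs @ r c # zs) y
              \<le> lhom X [f s] (r c) * lhom X (xs @ r c # zs) y"
            by (rule mult_mono_quantale) simp
          also have "\<dots> \<le> lhom X (xs @ f s # zs) y"
            using lvcat_subst[OF X xs, of "[f s]" zs "r c" y] zs y f[OF s] rob[OF cob] by simp
          finally show ?thesis .
        qed
        then show "lhom X (xs @ r c # zs) y
            \<le> (INF s\<in>ob A. qhom (\<phi> s) (lhom X (xs @ f s # zs) y))"
          by (simp add: le_INF_qhom_iff)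
      next
        \<comment> \<open>Multiplication in \<open>Q\<close> preserves the colimit, so the infimum
          is a hom out of a product in \<open>Q\<close>, and \<open>r\<close> carries it back to
          \<open>X\<close>.\<close>
        have "(INF s\<in>ob A. qhom (\<phi> s) (lhom X (xs @ f s # zs) y))
            = (INF s\<in>ob A. qhom (\<phi> s) (hom Q (mul Q ?a (mul Q (i (f s)) ?b)) (i y)))"
          using homX[of "xs @ f _ # zs" y] xs zs y f iob prod by (intro INF_cong) auto
        also have "\<dots> = hom Q (mul Q ?a (mul Q c ?b)) (i y)"
          using colim iob[OF y] by (simp add: is_colimit_def)
        also have "\<dots> \<le> lhom X (xs @ r c # zs) y"
          using hom_r[of "map i xs @ c # map i zs" "i y"] prod[OF cob] map_ri[OF xs] map_ri[OF zs]
            iobs[OF xs] iobs[OF zs] cob iob[OF y] ri[OF y] by simp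
        finally show "(INF s\<in>ob A. qhom (\<phi> s) (lhom X (xs @ f s # zs) y))
            \<le> lhom X (xs @ r c # zs) y" .
      qed
      then show "hom R (t (xs @ r c # zs)) y
          = (INF s\<in>ob A. qhom (\<phi> s) (hom R (t (xs @ f s # zs)) y))"
        using f eq rob[OF cob] by simp
    qed
  qed
  have colim_R: "\<exists>c. is_colimit R A f \<phi> (r c) \<and> is_colimit Q A (i \<circ> f) \<phi> c"
    if w: "is_weight S R A f \<phi>" for A f \<phi>
  proof -
    obtain c where c: "is_colimit Q A (i \<circ> f) \<phi> c"
      using Qc weight[OF w] unfolding cocomplete_def by blast
    have "f s \<in> lob X" if "s \<in> ob A" for s
      using that w by (auto simp: is_weight_def vfunctor_def)
    moreover have "r c \<in> lob X" using c rob by (simp add: is_colimit_def)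
    ultimately have "is_colimit R A f \<phi> (r c)"
      using key[OF w c, of "[]" "[]"] by (simp add: is_colimit_def t1)
    then show ?thesis using c by blast
  qed
  have colim_unique: "c = c'" if "is_colimit R A f \<phi> c" "is_colimit R A f \<phi> c'" for A f \<phi> c c'
    using that by (intro vseparated_eqI[OF Rv Rs]) (auto simp: is_colimit_def)
  have cc: "cocontinuous S R R (\<lambda>y. t (xs @ y # zs))"
    if xs: "xs \<in> lists (lob X)" and zs: "zs \<in> lists (lob X)" for xs zs
    unfolding cocontinuous_def
  proof (intro conjI allI impI)
    show "vfunctor R R (\<lambda>y. t (xs @ y # zs))"
      unfolding vfunctor_def
    proof (intro conjI ballI)
      show "(\<lambda>y. t (xs @ y # zs)) \<in> ob R \<rightarrow> ob R" using xs zs by (auto simp: tob)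
      fix y y' assume y: "y \<in> ob R" "y' \<in> ob R"
      let ?w = "t (xs @ y' # zs)"
      have w: "?w \<in> lob X" "1 \<le> lhom X (xs @ y' # zs) ?w"
        using xs zs y tob hom_t by auto
      have "lhom X [y] y' * 1 \<le> lhom X [y] y' * lhom X (xs @ y' # zs) ?w"
        by (intro mult_mono_quantale order_refl w)
      also have "\<dots> \<le> lhom X (xs @ y # zs) ?w"
        using lvcat_subst[OF X xs, of "[y]" zs y' ?w] zs y w by simp
      also have "\<dots> = lhom X [t (xs @ y # zs)] ?w"
        using hom_t_eq[of "xs @ y # zs" ?w] xs zs y w by simp
      finally show "hom R y y' \<le> hom R (t (xs @ y # zs)) ?w" by simp
    qed
  next
    fix A f \<phi> c assume *: "is_weight S R A f \<phi> \<and> is_colimit R A f \<phi> c"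
    then obtain c' where c': "is_colimit R A f \<phi> (r c')" "is_colimit Q A (i \<circ> f) \<phi> c'"
      using colim_R by blast
    \<comment> \<open>By uniqueness every colimit in \<open>R\<close> is the image of a colimit in
      \<open>Q\<close>, which is the form that \<open>key\<close> requires.\<close>
    then have "c = r c'" using * colim_unique by blast
    then show "is_colimit R A ((\<lambda>y. t (xs @ y # zs)) \<circ> f) \<phi> (t (xs @ c # zs))"
      using key[OF _ c'(2) xs zs] * by (simp add: o_def)
  qed
  have "vquantale S R"
    unfolding vquantale_def
  proof (intro conjI ballI Rm Rs)
    show "cocomplete S R" unfolding cocomplete_def using colim_R by blast
    fix x assume "x \<in> ob R"
    then show "cocontinuous S R R (\<lambda>y. mul R x y)" "cocontinuous S R R (\<lambda>y. mul R y x)"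
      using cc[of "[x]" "[]"] cc[of "[]" "[x]"] by simp_all
  qed
  \<comment> \<open>Off the domain both structure maps are \<open>undefined\<close>, so the equality
    holds for all arguments.\<close>
  moreover have "lhom X xs y = lhom (Kmp R) xs y" for xs y
    using X hom_t_eq[of xs y] mprod_R[of xs] by (auto simp: Kmp_def is_lvcat_def)
  then have "X = Kmp R"
    by (intro lvcat.equality ext) (simp_all add: Kmp_def)
  ultimately show ?thesis by blast
qed


section \<open>Extension of functors into \<open>V\<close>-quantales\<close>

text \<open>The index set \<open>I\<close> need not be small: the colimit is taken over \<open>Q\<close> itself, weighted by the
  presheaf that the family generates.\<close>

lemma vquantale_family_colimit:
  assumes Q: "vquantale S Q" and small: "ob Q \<in> S" and g: "\<And>i. i \<in> I \<Longrightarrow> g i \<in> ob Q"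
  shows "\<exists>c\<in>ob Q. \<forall>p\<in>ob Q. \<forall>q\<in>ob Q. \<forall>y\<in>ob Q.
    hom Q (mul Q p (mul Q c q)) y = (INF i\<in>I. qhom (w i) (hom Q (mul Q p (mul Q (g i) q)) y))"
proof -
  have Qm: "is_mvcat Q" and Qc: "cocomplete S Q"
    and Qcc: "\<And>x. x \<in> ob Q \<Longrightarrow> cocontinuous S Q Q (\<lambda>y. mul Q x y)"
      "\<And>x. x \<in> ob Q \<Longrightarrow> cocontinuous S Q Q (\<lambda>y. mul Q y x)"
    using Q by (auto simp: vquantale_def)
  note Qv = mvcat_vcat[OF Qm]
  define A where "A = \<lparr>ob = ob Q, hom = hom Q\<rparr>"
  \<comment> \<open>A supremum of representables at the \<open>g i\<close>, scaled by
    \<open>w i\<close>.\<close>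
  define \<phi> where "\<phi> x = (SUP i\<in>I. w i * hom Q x (g i))" for x
  have obA: "ob A = ob Q" and homA: "hom A = hom Q" by (simp_all add: A_def)
  have "\<phi> x * hom Q x' x \<le> \<phi> x'" if x: "x \<in> ob Q" "x' \<in> ob Q" for x x'
    unfolding \<phi>_def[of x] SUP_mult_le_iff
  proof
    fix i assume i: "i \<in> I"
    have "w i * (hom Q x' x * hom Q x (g i)) \<le> w i * hom Q x' (g i)"
      using x g[OF i] Qv by (intro mult_mono_quantale order_refl) (auto simp: is_vcat_def)
    also have "\<dots> \<le> \<phi> x'" unfolding \<phi>_def by (rule SUP_upper[OF i])
    finally show "w i * hom Q x (g i) * hom Q x' x \<le> \<phi> x'" by (simp add: ac_simps)
  qed
  moreover have "is_vcat A" using Qv by (simp add: is_vcat_def obA homA)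
  ultimately have wt: "is_weight S Q A id \<phi>"
    using small
    by (simp add: is_weight_def vfunctor_def vop_def vself_def obA homA qhom_adjoint[symmetric])
  then obtain c where c: "is_colimit Q A id \<phi> c"
    using Qc unfolding cocomplete_def by blast
  show ?thesis
  proof (intro bexI ballI)
    show "c \<in> ob Q" using c by (simp add: is_colimit_def)
    fix p q y assume p: "p \<in> ob Q" and q: "q \<in> ob Q" and y: "y \<in> ob Q"
    let ?m = "\<lambda>x. mul Q p (mul Q x q)"
    have mob: "?m x \<in> ob Q" if "x \<in> ob Q" for x
      using that p q by (simp add: mvcatD[OF Qm])
    have wq: "is_weight S Q A ((\<lambda>x. mul Q x q) \<circ> id) \<phi>"
      using Qcc(2)[OF q] by (intro is_weight_comp[OF wt]) (simp add: cocontinuous_def)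
    have m_fun: "hom Q x x' \<le> hom Q (?m x) (?m x')" if "x \<in> ob Q" "x' \<in> ob Q" for x x'
    proof -
      have "hom Q x x' \<le> hom Q (mul Q x q) (mul Q x' q)"
        using Qcc(2)[OF q] that by (simp add: cocontinuous_def vfunctor_def)
      also have "\<dots> \<le> hom Q (?m x) (?m x')"
        using Qcc(1)[OF p] that q by (simp add: cocontinuous_def vfunctor_def mvcatD[OF Qm])
      finally show ?thesis .
    qed
    have "is_colimit Q A ((\<lambda>x. mul Q x q) \<circ> id) \<phi> (mul Q c q)"
      using Qcc(2)[OF q] wt c unfolding cocontinuous_def by blast
    then have "is_colimit Q A ((\<lambda>x. mul Q p x) \<circ> ((\<lambda>x. mul Q x q) \<circ> id)) \<phi> (?m c)"
      using Qcc(1)[OF p] wq unfolding cocontinuous_def by blast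
    then have "hom Q (?m c) y = (INF x\<in>ob Q. qhom (\<phi> x) (hom Q (?m x) y))"
      using y by (simp add: is_colimit_def obA)
    also have "\<dots> = (INF i\<in>I. qhom (w i) (hom Q (?m (g i)) y))"
    proof (rule eq_if_same_lower_bounds)
      fix v
      have "v \<le> (INF x\<in>ob Q. qhom (\<phi> x) (hom Q (?m x) y)) \<longleftrightarrow>
        (\<forall>x\<in>ob Q. \<forall>i\<in>I. w i * hom Q x (g i) * v \<le> hom Q (?m x) y)"
        unfolding le_INF_qhom_iff unfolding \<phi>_def SUP_mult_le_iff ..
      \<comment> \<open>Yoneda: a cocone is determined at the elements \<open>g i\<close>. One
        direction evaluates at \<open>x = g i\<close> on the identity, the other uses functoriality
        of \<open>?m\<close>.\<close>
      also have "\<dots> \<longleftrightarrow> (\<forall>i\<in>I. w i * v \<le> hom Q (?m (g i)) y)" (is "?l \<longleftrightarrow> ?r")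
      proof
        assume l: ?l
        show ?r
        proof
          fix i assume i: "i \<in> I"
          have "w i * 1 * v \<le> w i * hom Q (g i) (g i) * v"
            by (intro mult_mono_quantale order_refl hom_refl Qv g i)
          also have "\<dots> \<le> hom Q (?m (g i)) y" using l g i by blast
          finally show "w i * v \<le> hom Q (?m (g i)) y" by simp
        qed
      next
        assume r: ?r
        show ?l
        proof (intro ballI)
          fix x i assume x: "x \<in> ob Q" and i: "i \<in> I"
          have "hom Q x (g i) * (w i * v) \<le> hom Q (?m x) y"
            by (rule hom_trans_le[OF Qv mob[OF x] mob[OF g[OF i]] y m_fun[OF x g[OF i]]])
              (use r i in blast)
          then show "w i * hom Q x (g i) * v \<le> hom Q (?m x) y" by (simp add: ac_simps)
        qed
      qed
      finally show "v \<le> (INF x\<in>ob Q. qhom (\<phi> x) (hom Q (?m x) y)) \<longleftrightarrow>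
          v \<le> (INF i\<in>I. qhom (w i) (hom Q (?m (g i)) y))"
        by (simp add: le_INF_qhom_iff)
    qed
    finally show "hom Q (?m c) y = (INF i\<in>I. qhom (w i) (hom Q (?m (g i)) y))" .
  qed
qed

text \<open>\<open>h'\<close> is a functor because multiplication is cocontinuous in each variable,
  so that homs out of a product of colimits are tested on concatenated lists. It extends
  \<open>h\<close> by Yoneda, since \<open>m\<close> is fully faithful and \<open>Q\<close> is
  separated.\<close>

lemma vquantale_extension:
  assumes Q: "vquantale S Q" and small: "ob Q \<in> S" and Y: "is_lvcat Y" and Z: "is_lvcat Z"
    and m: "fully_faithful Y Z m" and h: "lvfunctor Y (Kmp Q) h"
  shows "\<exists>h'. lvfunctor Z (Kmp Q) h' \<and> (\<forall>y\<in>lob Y. h' (m y) = h y)"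
proof -
  have Qm: "is_mvcat Q" and Qs: "vseparated Q"
    using Q by (auto simp: vquantale_def)
  note Qv = mvcat_vcat[OF Qm]
  have hob: "h y \<in> ob Q" if "y \<in> lob Y" for y
    using lvfunctor_lob[OF h that] by simp
  then have hobs: "map h ys \<in> lists (ob Q)" if "ys \<in> lists (lob Y)" for ys
    using that by (intro map_in_lists)
  have mob: "m y \<in> lob Z" if "y \<in> lob Y" for y
    using m that by (auto simp: fully_faithful_def lvfunctor_def)
  then have mobs: "map m ys \<in> lists (lob Z)" if "ys \<in> lists (lob Y)" for ys
    using that by (intro map_in_lists)
  have hom_h: "lhom Y ys y \<le> hom Q (mprod Q (map h ys)) (h y)"
    if "ys \<in> lists (lob Y)" "y \<in> lob Y" for ys y
    using lvfunctor_lhom[OF h that] by (simp only: lhom_Kmp hobs hob that)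
  let ?L = "lists (lob Y)"
  let ?p = "\<lambda>ys. mprod Q (map h ys)"
  have pob: "?p ys \<in> ob Q" if "ys \<in> ?L" for ys
    by (intro mprod_ob Qm hobs that)
  \<comment> \<open>The factors \<open>p\<close> and \<open>q\<close> leave room for the rest of a
    product while one colimit in it is expanded.\<close>
  have "\<forall>z. \<exists>c\<in>ob Q. \<forall>p\<in>ob Q. \<forall>q\<in>ob Q. \<forall>y\<in>ob Q. hom Q (mul Q p (mul Q c q)) y
      = (INF ys\<in>?L. qhom (lhom Z (map m ys) z) (hom Q (mul Q p (mul Q (?p ys) q)) y))"
    by (intro allI vquantale_family_colimit[OF Q small] pob)
  \<comment> \<open>The choice ranges over the whole type, so \<open>h'\<close> has values in
    \<open>ob Q\<close> even outside \<open>lob Z\<close>.\<close>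
  then obtain h' where h'ob: "\<And>z. h' z \<in> ob Q"
    and h': "\<And>z p q y. p \<in> ob Q \<Longrightarrow> q \<in> ob Q \<Longrightarrow> y \<in> ob Q \<Longrightarrow> hom Q (mul Q p (mul Q (h' z) q)) y
      = (INF ys\<in>?L. qhom (lhom Z (map m ys) z) (hom Q (mul Q p (mul Q (?p ys) q)) y))"
    unfolding Bex_def by (elim choice[THEN exE]) blast
  have h'1: "hom Q (h' z) y = (INF ys\<in>?L. qhom (lhom Z (map m ys) z) (hom Q (?p ys) y))"
    if "y \<in> ob Q" for z y
    using h'[of "unt Q" "unt Q" y z] that h'ob pob
    by (simp add: mvcatD[OF Qm] cong: INF_cong_simp)
  have unit: "lhom Z (map m ys) z \<le> hom Q (?p ys) (h' z)" if "ys \<in> ?L" for ys z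
  proof -
    have "1 \<le> (INF ys\<in>?L. qhom (lhom Z (map m ys) z) (hom Q (?p ys) (h' z)))"
      using h'1[OF h'ob] hom_refl[OF Qv h'ob] by metis
    then show ?thesis using that by (simp add: le_INF_qhom_iff)
  qed
  \<comment> \<open>The colimits in the product are expanded from left to right; \<open>p\<close>
    collects the products of the lists already chosen and therefore varies in the induction.\<close>
  have le_hom: "v \<le> hom Q (mul Q p (mprod Q (map h' zs))) y"
    if "p \<in> ob Q" "y \<in> ob Q"
      "\<And>yss. yss \<in> lists ?L \<Longrightarrow> length yss = length zs \<Longrightarrow>
        prod_list (map2 (lhom Z) (map (map m) yss) zs) * v \<le> hom Q (mul Q p (?p (concat yss))) y"
    for v p zs y
    using that
  proof (induction zs arbitrary: v p)
    case Nil
    then show ?case using Nil(3)[of "[]"] by simp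
  next
    case (Cons z zs)
    let ?q = "mprod Q (map h' zs)"
    have q: "?q \<in> ob Q" by (intro mprod_ob Qm) (auto simp: in_lists_conv_set h'ob)
    have "lhom Z (map m ys) z * v \<le> hom Q (mul Q p (mul Q (?p ys) ?q)) y" if ys: "ys \<in> ?L" for ys
    proof -
      have "lhom Z (map m ys) z * v \<le> hom Q (mul Q (mul Q p (?p ys)) ?q) y"
      proof (rule Cons.IH)
        show "mul Q p (?p ys) \<in> ob Q" using Cons.prems(1) pob[OF ys] by (rule mul_ob[OF Qm])
        fix yss assume yss: "yss \<in> lists ?L" "length yss = length zs"
        then have c: "concat yss \<in> ?L" by (intro concat_in_lists)
        have "prod_list (map2 (lhom Z) (map (map m) (ys # yss)) (z # zs)) * v
            \<le> hom Q (mul Q p (?p (concat (ys # yss)))) y"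
          by (rule Cons.prems(3)) (use ys yss in auto)
        moreover have "?p (concat (ys # yss)) = mul Q (?p ys) (?p (concat yss))"
          using mprod_append[OF Qm hobs[OF ys] hobs[OF c]] by simp
        ultimately show "prod_list (map2 (lhom Z) (map (map m) yss) zs) * (lhom Z (map m ys) z * v)
            \<le> hom Q (mul Q (mul Q p (?p ys)) (?p (concat yss))) y"
          using pob[OF ys] pob[OF c] Cons.prems(1)
          by (simp add: mul_assoc[OF Qm] ac_simps)
      qed (rule Cons.prems)
      then show ?thesis using pob[OF ys] q Cons.prems(1) by (simp add: mul_assoc[OF Qm])
    qed
    then show ?case
      using h'[OF Cons.prems(1) q Cons.prems(2)] by (simp add: le_INF_qhom_iff)
  qed
  have "lhom Z zs z \<le> hom Q (mprod Q (map h' zs)) (h' z)"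
    if zs: "zs \<in> lists (lob Z)" and z: "z \<in> lob Z" for zs z
  proof -
    have "lhom Z zs z \<le> hom Q (mul Q (unt Q) (mprod Q (map h' zs))) (h' z)"
    proof (rule le_hom)
      fix yss assume yss: "yss \<in> lists ?L" "length yss = length zs"
      then have c: "concat yss \<in> ?L" by (intro concat_in_lists)
      \<comment> \<open>The composition law of \<open>Z\<close> merges the chosen lists into one, to
        which the cocone \<open>unit\<close> applies.\<close>
      have "prod_list (map2 (lhom Z) (map (map m) yss) zs) * lhom Z zs z
          \<le> lhom Z (concat (map (map m) yss)) z"
        using yss mobs zs z by (intro lvcat_comp[OF Z] map_in_lists[OF mobs]) auto
      also have "\<dots> \<le> hom Q (?p (concat yss)) (h' z)"
        using unit[OF c] by (simp add: map_concat)
      finally show "prod_list (map2 (lhom Z) (map (map m) yss) zs) * lhom Z zs z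
          \<le> hom Q (mul Q (unt Q) (?p (concat yss))) (h' z)"
        using pob[OF c] by (simp add: mvcatD[OF Qm])
    qed (simp_all add: h'ob mvcatD[OF Qm])
    moreover have "mprod Q (map h' zs) \<in> ob Q"
      by (intro mprod_ob Qm) (auto simp: in_lists_conv_set h'ob)
    ultimately show ?thesis by (simp add: mvcatD[OF Qm])
  qed
  then have "lvfunctor Z (Kmp Q) h'"
    by (auto simp: lvfunctor_def lhom_Kmp in_lists_conv_set h'ob)
  moreover have "h' (m y) = h y" if y: "y \<in> lob Y" for y
  proof (rule vseparated_eqI[OF Qv Qs h'ob hob[OF y]])
    fix x assume x: "x \<in> ob Q"
    \<comment> \<open>The weights at \<open>m y\<close> thus become those of the representable at
      \<open>y\<close>, and Yoneda gives \<open>h y\<close>: the singleton \<open>[y]\<close>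
      carries the identity, and \<open>hom_h\<close> handles the other lists.\<close>
    have eq: "lhom Z (map m ys) (m y) = lhom Y ys y" if "ys \<in> ?L" for ys
      using m that y by (simp add: fully_faithful_def)
    have "hom Q (h' (m y)) x = (INF ys\<in>?L. qhom (lhom Y ys y) (hom Q (?p ys) x))"
      using h'1[OF x] eq by simp
    also have "\<dots> = hom Q (h y) x"
    proof (rule eq_if_same_lower_bounds)
      fix v
      show "v \<le> (INF ys\<in>?L. qhom (lhom Y ys y) (hom Q (?p ys) x)) \<longleftrightarrow> v \<le> hom Q (h y) x"
        unfolding le_INF_qhom_iff
      proof
        assume "\<forall>ys\<in>?L. lhom Y ys y * v \<le> hom Q (?p ys) x"
        then have "lhom Y [y] y * v \<le> hom Q (?p [y]) x" using y by blast
        moreover have "1 * v \<le> lhom Y [y] y * v"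
          using Y y by (intro mult_mono_quantale) (auto simp: is_lvcat_def)
        moreover have "?p [y] = h y" using hob[OF y] by (simp add: mvcatD[OF Qm])
        ultimately show "v \<le> hom Q (h y) x" by (metis mult_1 order_trans)
      next
        assume "v \<le> hom Q (h y) x"
        then show "\<forall>ys\<in>?L. lhom Y ys y * v \<le> hom Q (?p ys) x"
          using hom_trans_le[OF Qv pob hob[OF y] x hom_h[OF _ y]] by blast
      qed
    qed
    finally show "hom Q (h' (m y)) x = hom Q (h y) x" .
  qed
  ultimately show ?thesis by blast
qed

text \<open>Smallness is relative to \<open>S\<close>: members of \<open>C\<close> have carriers in
  \<open>S\<close>, and \<open>presheaves_small\<close> makes room inside \<open>'u\<close> for the
  function quantale into which \<open>X\<close> embeds.\<close>

theorem theorem6p22: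
  fixes S :: "'u set set"
    and C :: "('u, 'v::comm_quantale) lvcat set"
    and X :: "('u, 'v) lvcat"
  assumes nontrivial: "(1::'v) \<noteq> bot"
    and subsets: "\<And>A B. A \<in> S \<Longrightarrow> B \<subseteq> A \<Longrightarrow> B \<in> S"
    and presheaves_small:
      "\<exists>P\<in>S. \<exists>e. inj_on e (lists (lob X) \<rightarrow>\<^sub>E (UNIV :: 'v set)) \<and>
                 e ` (lists (lob X) \<rightarrow>\<^sub>E (UNIV :: 'v set)) \<subseteq> P"
    and subcategory: "\<And>Y. Y \<in> C \<Longrightarrow> is_lvcat Y \<and> lob Y \<in> S"
    and contains_quantales: "\<And>Q. vquantale S Q \<Longrightarrow> ob Q \<in> S \<Longrightarrow> Kmp Q \<in> C"
    and object: "X \<in> C"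
    and separated: "lvseparated X"
  shows "injective_wrt C fully_faithful X \<longleftrightarrow> (\<exists>Q. vquantale S Q \<and> X = Kmp Q)"
proof
  assume inj: "injective_wrt C fully_faithful X"
  from presheaves_small obtain P e
    where P: "P \<in> S" and e: "inj_on e (lists (lob X) \<rightarrow>\<^sub>E (UNIV :: 'v set))"
      and eP: "e ` (lists (lob X) \<rightarrow>\<^sub>E (UNIV :: 'v set)) \<subseteq> P"
    by blast
  interpret function_encoding "lob X" e
    by unfold_locales (rule e)
  have X: "is_lvcat X" using subcategory object by blast
  have "ob fq \<in> S"
    using subsets[OF P] ob_fq_subset eP by blast
  then have "Kmp fq \<in> C" by (intro contains_quantales vquantale_fq)
  moreover have ff: "fully_faithful X (Kmp fq) (yoneda X)"
    by (rule fully_faithful_yoneda[OF X refl])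
  moreover have "lvfunctor X X id" by (simp add: lvfunctor_def)
  \<comment> \<open>Extending the identity of \<open>X\<close> along the embedding yields a
    retraction.\<close>
  ultimately obtain r where r: "lvfunctor (Kmp fq) X r" "\<forall>x\<in>lob X. r (yoneda X x) = id x"
    using inj object unfolding injective_wrt_def fully_faithful_def by blast
  show "\<exists>Q. vquantale S Q \<and> X = Kmp Q"
    by (rule retract_vquantale[OF vquantale_fq X separated ff r(1)]) (use r(2) in simp)
next
  assume "\<exists>Q. vquantale S Q \<and> X = Kmp Q"
  then obtain Q where Q: "vquantale S Q" and X: "X = Kmp Q" by blast
  \<comment> \<open>\<open>Q\<close> has the carrier of \<open>X\<close>, a member of
    \<open>C\<close>; this makes \<open>Q\<close> small enough to index the colimits of the
    extension.\<close>
  have "ob Q \<in> S" using subcategory[OF object] by (simp add: X Kmp_def)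
  then show "injective_wrt C fully_faithful X"
    unfolding injective_wrt_def X using vquantale_extension[OF Q] subcategory by blast
qed

end
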